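(* Let $0<s<2m$ with $s\neq m$, let $t$ be a legitimate quadruple, and let $l\in L^*\setminus(L^* )^{\sigma-1}$ (so $l\neq 0$). Let $S$ be a semifield isotopic to $B(2,m,s,l,t)$. Then the middle nucleus of $S$ is a quadratic extension of the center of $S$.
   Context: A (finite) presemifield is a finite additive abelian group with a multiplication that is distributive on both sides over addition and has no zero divisors; it is a semifield if it also has a multiplicative identity. Two presemifields $(F,+,* )$ and $(F,+,\circ)$ are isotopic if there are additive bijections $\alpha_1,\alpha_2,\beta$ with $\beta(\alpha_1(x)*\alpha_2(y))=x\circ y$ for all $x,y$. In a semifield, an element $u$ belongs to the left, middle, right nucleus if, respectively, $u*(y*w)=(u*y)*w$, $y*(u*w)=(y*u)*w$, $y*(w*u)=(y*w)*u$ for all $y,w$; the center consists of the elements in all three nuclei that commute with every element. Let $m\ge 1$, $L=GF(2^m)$, $\sigma=2^s$, $(L^* )^{\sigma-1}=\{u^{\sigma-1}:u\in L^*\}$. A quadruple $t=[p_1,p_2,p_3,p_4]\in L^4$ is legitimate if $p_1\neq0$ and $p_1X^{\sigma+1}+p_2X^{\sigma}+p_3X+p_4$ has no root in $L$. $B(2,m,s,l,t)$ is the presemifield on $L\times L$ with multiplication $$(a,b)\circ(c,d)=(p_1ac^{\sigma}+lp_1a^{\sigma}c+p_2bc^{\sigma}+lp_2a^{\sigma}d+p_3ad^{\sigma}+lp_3b^{\sigma}c+p_4bd^{\sigma}+lp_4b^{\sigma}d,\ ad+bc).$$ *)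

theory Defs
  imports
    "HOL-Library.Cardinality"
    "HOL-Library.Product_Plus"
    "HOL-Algebra.Embedded_Algebras"
begin

text \<open>
  The additive group of a presemifield is a finite type of class \<open>ab_group_add\<close>, so a
  presemifield is given by its multiplication alone.
\<close>

locale finite_presemifield =
  fixes ml :: "'a::{finite, ab_group_add} \<Rightarrow> 'a \<Rightarrow> 'a"
  assumes distrib_right: "ml (x + y) z = ml x z + ml y z"
    and distrib_left: "ml x (y + z) = ml x y + ml x z"
    and no_zero_divisors: "ml x y = 0 \<Longrightarrow> x = 0 \<or> y = 0"

locale finite_semifield = finite_presemifield ml
  for ml :: "'a::{finite, ab_group_add} \<Rightarrow> 'a \<Rightarrow> 'a" +
  fixes e :: 'a
  assumes left_unit: "ml e x = x"
    and right_unit: "ml x e = x"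

definition isotopic ::
  "('a::{finite, ab_group_add} \<Rightarrow> 'a \<Rightarrow> 'a) \<Rightarrow> ('b::{finite, ab_group_add} \<Rightarrow> 'b \<Rightarrow> 'b) \<Rightarrow> bool"
  where
  "isotopic f g \<longleftrightarrow>
     (\<exists>\<alpha>\<^sub>1 \<alpha>\<^sub>2 \<beta>. additive \<alpha>\<^sub>1 \<and> bij \<alpha>\<^sub>1 \<and> additive \<alpha>\<^sub>2 \<and> bij \<alpha>\<^sub>2 \<and> additive \<beta> \<and> bij \<beta> \<and>
        (\<forall>x y. \<beta> (f (\<alpha>\<^sub>1 x) (\<alpha>\<^sub>2 y)) = g x y))"

definition left_nucleus :: "('a \<Rightarrow> 'a \<Rightarrow> 'a) \<Rightarrow> 'a set" where
  "left_nucleus f = {u. \<forall>y w. f u (f y w) = f (f u y) w}"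

definition middle_nucleus :: "('a \<Rightarrow> 'a \<Rightarrow> 'a) \<Rightarrow> 'a set" where
  "middle_nucleus f = {u. \<forall>y w. f y (f u w) = f (f y u) w}"

definition right_nucleus :: "('a \<Rightarrow> 'a \<Rightarrow> 'a) \<Rightarrow> 'a set" where
  "right_nucleus f = {u. \<forall>y w. f y (f w u) = f (f y w) u}"

definition semifield_center :: "('a \<Rightarrow> 'a \<Rightarrow> 'a) \<Rightarrow> 'a set" where
  "semifield_center f =
     {u \<in> left_nucleus f \<inter> middle_nucleus f \<inter> right_nucleus f. \<forall>y. f u y = f y u}"

definition middle_nucleus_ring ::
  "('a::ab_group_add \<Rightarrow> 'a \<Rightarrow> 'a) \<Rightarrow> 'a \<Rightarrow> 'a ring" where
  "middle_nucleus_ring f e =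
     \<lparr>carrier = middle_nucleus f, mult = f, one = e, zero = 0, add = (+)\<rparr>"

definition quadratic_extension :: "('a, 'b) ring_scheme \<Rightarrow> 'a set \<Rightarrow> bool" where
  "quadratic_extension R K \<longleftrightarrow>
     field R \<and> subfield K R \<and> ring.dimension R 2 K (carrier R)"

text \<open>
  In the remaining definitions the finite field \<open>L\<close> is the type \<open>'a\<close>, and \<open>\<sigma> = 2 ^ s\<close>.
\<close>

definition legitimate :: "nat \<Rightarrow> 'a::field \<times> 'a \<times> 'a \<times> 'a \<Rightarrow> bool" where
  "legitimate s = (\<lambda>(p\<^sub>1, p\<^sub>2, p\<^sub>3, p\<^sub>4). p\<^sub>1 \<noteq> 0 \<and>
     (let \<sigma> = 2 ^ s in
      \<not> (\<exists>x. p\<^sub>1 * x ^ (\<sigma> + 1) + p\<^sub>2 * x ^ \<sigma> + p\<^sub>3 * x + p\<^sub>4 = 0)))"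

definition unit_powers :: "nat \<Rightarrow> 'a::field set" where
  "unit_powers k = {u ^ k | u. u \<noteq> 0}"

definition B_mult ::
  "nat \<Rightarrow> 'a::field \<Rightarrow> 'a \<times> 'a \<times> 'a \<times> 'a \<Rightarrow> 'a \<times> 'a \<Rightarrow> 'a \<times> 'a \<Rightarrow> 'a \<times> 'a" where
  "B_mult s l = (\<lambda>(p\<^sub>1, p\<^sub>2, p\<^sub>3, p\<^sub>4) (a, b) (c, d).
     let \<sigma> = 2 ^ s in
     (p\<^sub>1 * a * c ^ \<sigma> + l * p\<^sub>1 * a ^ \<sigma> * c
      + p\<^sub>2 * b * c ^ \<sigma> + l * p\<^sub>2 * a ^ \<sigma> * d
      + p\<^sub>3 * a * d ^ \<sigma> + l * p\<^sub>3 * b ^ \<sigma> * c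
      + p\<^sub>4 * b * d ^ \<sigma> + l * p\<^sub>4 * b ^ \<sigma> * d,
      a * d + b * c))"

end

theory Submission
  imports "HOL-Computational_Algebra.Polynomial" Defs
begin

text \<open>
  Put \<open>[u, v] = u\<^sub>1v\<^sub>2 + u\<^sub>2v\<^sub>1\<close> on \<open>L\<^sup>2\<close>. The quadruple \<open>t\<close> encodes a \<open>\<sigma>\<close>-semilinear map \<open>T\<close> of
  \<open>L\<^sup>2\<close> such that the product is \<open>x \<circ> y = ([x, Ty] + l[y, Tx], [x, y])\<close>, and \<open>t\<close> is legitimate iff
  \<open>[x, Tx] \<noteq> 0\<close> for \<open>x \<noteq> 0\<close>. The middle nucleus corresponds to the pairs \<open>(A, B)\<close> with
  \<open>Ax \<circ> y = x \<circ> By\<close>. The second coordinate makes \<open>A\<close> linear over \<open>L\<close> with adjoint \<open>B\<close>; comparing in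
  the first one the parts linear and \<open>\<sigma>\<close>-semilinear in \<open>x\<close> gives \<open>AT = TA\<close>. Let \<open>n\<close> be the order of
  \<open>\<sigma>\<close> on \<open>L\<close>. The linear map \<open>N = T\<^sup>n\<close> is not scalar, because by Hilbert 90 a scalar \<open>N\<close> would yield
  some \<open>x \<noteq> 0\<close> with \<open>Tx \<in> Lx\<close>. Hence the commutant of \<open>T\<close> is \<open>K + KN\<close>, where \<open>K\<close> is the fixed
  field of \<open>\<sigma>\<close>, and the center corresponds to \<open>K\<close>.
\<close>

section \<open>Semifields with a quadratic middle nucleus\<close>

context finite_semifield
begin

lemma mult_zero_left: "ml 0 x = 0"
  using distrib_right[of 0 0 x] by simp

lemma mult_zero_right: "ml x 0 = 0"
  using distrib_left[of x 0 0] by simp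

lemma mult_diff_left: "ml (x - y) z = ml x z - ml y z"
  using distrib_right[of "x - y" y z] by (simp add: algebra_simps)

lemma mult_diff_right: "ml x (y - z) = ml x y - ml x z"
  using distrib_left[of x "y - z" z] by (simp add: algebra_simps)

text \<open>Inverses come from finiteness: multiplication by a nonzero \<open>x\<close> maps
  \<open>H\<close> injectively into itself, hence onto, and so hits \<open>e\<close>.\<close>

lemma closed_set_field:
  assumes e: "e \<in> H" "e \<noteq> 0"
    and diff: "\<And>x y. x \<in> H \<Longrightarrow> y \<in> H \<Longrightarrow> x - y \<in> H"
    and mult: "\<And>x y. x \<in> H \<Longrightarrow> y \<in> H \<Longrightarrow> ml x y \<in> H"
    and comm: "\<And>x y. x \<in> H \<Longrightarrow> y \<in> H \<Longrightarrow> ml x y = ml y x"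
    and assoc: "\<And>x y z. x \<in> H \<Longrightarrow> y \<in> H \<Longrightarrow> z \<in> H \<Longrightarrow> ml (ml x y) z = ml x (ml y z)"
  shows "field \<lparr>carrier = H, mult = ml, one = e, zero = 0, add = (+)\<rparr>"
    (is "field ?R")
proof -
  have zero: "0 \<in> H"
    using diff[OF e(1) e(1)] by simp
  have uminus: "- x \<in> H" if "x \<in> H" for x
    using diff[OF zero that] by simp
  have add: "x + y \<in> H" if "x \<in> H" "y \<in> H" for x y
    using diff[OF that(1) uminus[OF that(2)]] by simp
  have "abelian_group ?R"
  proof (rule abelian_groupI)
    show "\<exists>y\<in>carrier ?R. y \<oplus>\<^bsub>?R\<^esub> x = \<zero>\<^bsub>?R\<^esub>" if "x \<in> carrier ?R" for x
      using that uminus[of x] by (auto intro!: bexI[of _ "- x"])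
  qed (auto simp: zero add algebra_simps)
  moreover have "comm_monoid ?R"
    by (rule comm_monoidI, simp_all add: e mult assoc left_unit) (rule comm)
  ultimately have cring: "cring ?R"
    by (rule cringI) (auto simp: distrib_right)
  have "\<exists>y\<in>H. ml x y = e" if x: "x \<in> H" "x \<noteq> 0" for x
  proof -
    have "inj_on (ml x) H"
      by (rule inj_onI)
        (metis mult_diff_right no_zero_divisors right_minus_eq x(2))
    moreover have "ml x ` H \<subseteq> H"
      using mult x by auto
    ultimately have "ml x ` H = H"
      by (intro endo_inj_surj) auto
    then show ?thesis
      using e(1) by (metis imageE)
  qed
  then have "Units ?R = carrier ?R - {\<zero>\<^bsub>?R\<^esub>}"
    using comm e(2) by (auto simp: Units_def mult_zero_left mult_zero_right)
  then show ?thesis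
    by (rule cring.cring_fieldI[OF cring])
qed

lemma middle_nucleusD:
  "u \<in> middle_nucleus ml \<Longrightarrow> ml (ml y u) w = ml y (ml u w)"
  by (simp only: middle_nucleus_def mem_Collect_eq)

lemma semifield_centerD:
  assumes "u \<in> semifield_center ml"
  shows "ml u y = ml y u" "ml (ml u y) w = ml u (ml y w)"
    "ml (ml y u) w = ml y (ml u w)" "ml (ml y w) u = ml y (ml w u)"
proof -
  have *: "\<forall>y w. ml u (ml y w) = ml (ml u y) w" "\<forall>y w. ml y (ml u w) = ml (ml y u) w"
    "\<forall>y w. ml y (ml w u) = ml (ml y w) u" "\<forall>y. ml u y = ml y u"
    using assms unfolding semifield_center_def left_nucleus_def middle_nucleus_def
      right_nucleus_def Int_iff mem_Collect_eq by iprover+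
  show "ml u y = ml y u" "ml (ml u y) w = ml u (ml y w)"
    "ml (ml y u) w = ml y (ml u w)" "ml (ml y w) u = ml y (ml w u)"
    by (rule *[rule_format, symmetric] *(4)[rule_format])+
qed

text \<open>The right nucleus condition follows:
  \<open>y(wu) = y(uw) = (yu)w = (uy)w = u(yw) = (yw)u\<close>.\<close>

lemma semifield_centerI:
  assumes "\<And>y. ml u y = ml y u" "\<And>y w. ml (ml u y) w = ml u (ml y w)"
    "\<And>y w. ml (ml y u) w = ml y (ml u w)"
  shows "u \<in> semifield_center ml"
proof -
  have "ml y (ml w u) = ml (ml y w) u" for y w
    by (metis assms)
  with assms show ?thesis
    unfolding semifield_center_def left_nucleus_def middle_nucleus_def right_nucleus_def
    by simp
qed

text \<open>Everything in the span of \<open>e\<close> and \<open>th\<close> over the center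
  commutes, so the middle nucleus is a field; as \<open>th\<close> is not central, \<open>e\<close>
  and \<open>th\<close> are independent.\<close>

lemma quadratic_extension_middle_nucleus:
  assumes th: "th \<in> middle_nucleus ml" "th \<notin> semifield_center ml"
    and span: "\<And>u. u \<in> middle_nucleus ml \<Longrightarrow>
      \<exists>z1\<in>semifield_center ml. \<exists>z2\<in>semifield_center ml. u = ml z1 th + z2"
  shows "quadratic_extension (middle_nucleus_ring ml e) (semifield_center ml)"
proof -
  let ?M = "middle_nucleus ml" and ?Z = "semifield_center ml"
  let ?R = "middle_nucleus_ring ml e"
  have ZM: "?Z \<subseteq> ?M"
    by (auto simp: semifield_center_def)
  have Ze: "e \<in> ?Z"
    by (rule semifield_centerI) (simp_all add: left_unit right_unit)
  have e0: "e \<noteq> 0"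
  proof
    \<comment> \<open>The semifield would be trivial, and \<open>th\<close> would equal the central
      element \<open>e\<close>.\<close>
    assume "e = 0"
    then have "x = 0" for x :: 'a
      using left_unit[of x] mult_zero_left by simp
    then show False
      using th(2) Ze by (metis)
  qed
  have Z0: "0 \<in> ?Z"
    by (rule semifield_centerI) (simp_all add: mult_zero_left mult_zero_right)
  have Zdiff: "x - y \<in> ?Z" if "x \<in> ?Z" "y \<in> ?Z" for x y
    by (rule semifield_centerI)
      (simp_all add: mult_diff_left mult_diff_right semifield_centerD[OF that(1)]
        semifield_centerD[OF that(2)])
  have Zmult: "ml x y \<in> ?Z" if "x \<in> ?Z" "y \<in> ?Z" for x y
  proof (rule semifield_centerI)
    fix u w
    note a = semifield_centerD[OF that(1)] and b = semifield_centerD[OF that(2)]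
    have "ml (ml x y) u = ml (ml x u) y"
      by (simp add: a(2) b(1))
    also have "\<dots> = ml u (ml x y)"
      by (simp only: a(1)[of u] a(3))
    finally show "ml (ml x y) u = ml u (ml x y)" .
    show "ml (ml (ml x y) u) w = ml (ml x y) (ml u w)"
      by (simp add: a(2) b(2))
    have "ml (ml u (ml x y)) w = ml (ml (ml u x) y) w"
      by (simp add: a(3))
    also have "\<dots> = ml (ml u x) (ml y w)"
      by (rule b(3))
    also have "\<dots> = ml u (ml (ml x y) w)"
      by (simp only: a(2,3))
    finally show "ml (ml u (ml x y)) w = ml u (ml (ml x y) w)" .
  qed
  have Mdiff: "x - y \<in> ?M" if "x \<in> ?M" "y \<in> ?M" for x y
    using that by (simp add: middle_nucleus_def mult_diff_left mult_diff_right)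
  have Mmult: "ml x y \<in> ?M" if "x \<in> ?M" "y \<in> ?M" for x y
  proof -
    have "ml (ml z (ml x y)) w = ml z (ml (ml x y) w)" for z w
    proof -
      have "ml (ml z (ml x y)) w = ml (ml (ml z x) y) w"
        by (simp only: middle_nucleusD[OF that(1)])
      also have "\<dots> = ml (ml z x) (ml y w)"
        by (rule middle_nucleusD[OF that(2)])
      also have "\<dots> = ml z (ml (ml x y) w)"
        by (simp only: middle_nucleusD[OF that(1)] middle_nucleusD[OF that(2)])
      finally show ?thesis .
    qed
    then show ?thesis
      unfolding middle_nucleus_def by simp
  qed
  have comm_th: "ml u th = ml th u" if u: "u \<in> ?M" for u
  proof -
    obtain a b where ab: "a \<in> ?Z" "b \<in> ?Z" "u = ml a th + b"
      using span[OF u] by blast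
    have "ml (ml a th) th = ml th (ml a th)"
      by (simp only: semifield_centerD(1)[OF ab(1), of th] semifield_centerD(3)[OF ab(1)])
    then show ?thesis
      by (simp add: ab(3) distrib_left distrib_right semifield_centerD(1)[OF ab(2)])
  qed
  have comm: "ml x y = ml y x" if xy: "x \<in> ?M" "y \<in> ?M" for x y
  proof -
    obtain a b where ab: "a \<in> ?Z" "b \<in> ?Z" "x = ml a th + b"
      using span[OF xy(1)] by blast
    have "ml (ml a th) y = ml a (ml y th)"
      by (simp add: semifield_centerD(2)[OF ab(1)] comm_th[OF xy(2)])
    also have "\<dots> = ml (ml y a) th"
      by (simp flip: semifield_centerD(1,2)[OF ab(1)])
    also have "\<dots> = ml y (ml a th)"
      by (rule semifield_centerD(3)[OF ab(1)])
    finally have "ml (ml a th) y = ml y (ml a th)" .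
    then show ?thesis
      by (simp add: ab(3) distrib_left distrib_right semifield_centerD(1)[OF ab(2)])
  qed
  have fR: "field ?R"
    unfolding middle_nucleus_ring_def
    by (rule closed_set_field[OF subsetD[OF ZM Ze] e0 Mdiff Mmult comm middle_nucleusD])
  then interpret R: field ?R .
  have "?R\<lparr>carrier := ?Z\<rparr> = \<lparr>carrier = ?Z, mult = ml, one = e, zero = 0, add = (+)\<rparr>"
    by (simp add: middle_nucleus_ring_def)
  moreover have "field \<dots>"
    by (rule closed_set_field[OF Ze e0 Zdiff Zmult semifield_centerD(1) semifield_centerD(2)])
  ultimately have fZ: "field (?R\<lparr>carrier := ?Z\<rparr>)"
    by simp
  have sub: "subfield ?Z ?R"
    by (rule R.subfield_iff(1)[OF fZ]) (simp add: middle_nucleus_ring_def ZM)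
  have carrier: "carrier ?R = ?M" and zeroR: "\<zero>\<^bsub>?R\<^esub> = 0"
    and multR: "a \<otimes>\<^bsub>?R\<^esub> b = ml a b" and addR: "a \<oplus>\<^bsub>?R\<^esub> b = a + b" for a b
    by (simp_all add: middle_nucleus_ring_def)
  \<comment> \<open>The dimension is built one vector at a time: \<open>e\<close> extends zero to
    the center, \<open>th\<close> extends the center to the middle nucleus.\<close>
  have "R.line_extension ?Z e {0} = ?Z"
    by (auto simp: R.line_extension_mem_iff multR addR right_unit)
  moreover have "R.dimension 0 ?Z {0}"
    using R.zero_dim[of ?Z] by (simp only: zeroR)
  ultimately have "R.dimension 1 ?Z ?Z"
    using R.Suc_dim[of e "{0}" 0 ?Z] Ze ZM e0 by (auto simp: carrier)
  then have "R.dimension 2 ?Z (R.line_extension ?Z th ?Z)"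
    using R.Suc_dim[of th ?Z 1 ?Z] th by (simp add: carrier numeral_2_eq_2)
  moreover have "R.line_extension ?Z th ?Z = ?M"
  proof
    show "R.line_extension ?Z th ?Z \<subseteq> ?M"
      using R.line_extension_in_carrier[of ?Z th ?Z] ZM th(1) by (simp add: carrier)
    show "?M \<subseteq> R.line_extension ?Z th ?Z"
      using span by (auto simp: R.line_extension_mem_iff multR addR)
  qed
  ultimately show ?thesis
    unfolding quadratic_extension_def using fR sub carrier by simp
qed

end

section \<open>Nuclei of an isotope\<close>

text \<open>HOL-Algebra takes the syntax \<open>inv\<close> for group inverses.\<close>

abbreviation (input) finv :: "('a \<Rightarrow> 'b) \<Rightarrow> 'b \<Rightarrow> 'a" where
  "finv \<equiv> inv_into UNIV"

locale semifield_isotopy = finite_semifield ml e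
  for ml :: "'a::{finite, ab_group_add} \<Rightarrow> 'a \<Rightarrow> 'a" and e :: 'a +
  fixes g :: "'b::{finite, ab_group_add} \<Rightarrow> 'b \<Rightarrow> 'b"
    and \<alpha>\<^sub>1 \<alpha>\<^sub>2 :: "'b \<Rightarrow> 'a" and \<beta> :: "'a \<Rightarrow> 'b"
  assumes bij: "bij \<alpha>\<^sub>1" "bij \<alpha>\<^sub>2" "bij \<beta>"
    and isotopy: "\<beta> (ml (\<alpha>\<^sub>1 x) (\<alpha>\<^sub>2 y)) = g x y"
begin

text \<open>\<open>g\<close> need not have an identity; such pairs carry the middle nucleus across
  the isotopy.\<close>

definition adjoint_pair :: "('b \<Rightarrow> 'b) \<Rightarrow> ('b \<Rightarrow> 'b) \<Rightarrow> bool" where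
  "adjoint_pair A B \<longleftrightarrow> (\<forall>x y. g (A x) y = g x (B y))"

definition nucleus_element :: "('b \<Rightarrow> 'b) \<Rightarrow> 'a" where
  "nucleus_element A = \<alpha>\<^sub>1 (A (finv \<alpha>\<^sub>1 e))"

lemma inv_simps [simp]:
  "\<alpha>\<^sub>1 (finv \<alpha>\<^sub>1 x) = x" "\<alpha>\<^sub>2 (finv \<alpha>\<^sub>2 x) = x" "\<beta> (finv \<beta> z) = z"
  "finv \<alpha>\<^sub>1 (\<alpha>\<^sub>1 z) = z" "finv \<alpha>\<^sub>2 (\<alpha>\<^sub>2 z) = z" "finv \<beta> (\<beta> x) = x"
  by (simp_all only: bij[THEN bij_is_surj, THEN surj_f_inv_f] bij[THEN bij_is_inj, THEN inv_f_f])

lemma adjoint_pair_mult: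
  assumes "adjoint_pair A B"
  shows "ml (\<alpha>\<^sub>1 (A x)) (\<alpha>\<^sub>2 y) = ml (\<alpha>\<^sub>1 x) (\<alpha>\<^sub>2 (B y))"
proof -
  have "\<beta> (ml (\<alpha>\<^sub>1 (A x)) (\<alpha>\<^sub>2 y)) = \<beta> (ml (\<alpha>\<^sub>1 x) (\<alpha>\<^sub>2 (B y)))"
    using assms by (simp add: isotopy adjoint_pair_def)
  then show ?thesis
    using bij(3) by (meson bij_is_inj injD)
qed

text \<open>Setting one factor to the preimage of \<open>e\<close> turns \<open>A\<close> into a
  right and \<open>B\<close> into a left multiplication; evaluating at both preimages shows that the
  multipliers agree.\<close>

lemma nucleus_element_mult:
  assumes "adjoint_pair A B"
  shows "ml (\<alpha>\<^sub>1 x) (nucleus_element A) = \<alpha>\<^sub>1 (A x)"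
    and "ml (nucleus_element A) (\<alpha>\<^sub>2 y) = \<alpha>\<^sub>2 (B y)"
proof -
  have *: "\<alpha>\<^sub>1 (A x) = ml (\<alpha>\<^sub>1 x) (\<alpha>\<^sub>2 (B (finv \<alpha>\<^sub>2 e)))" for x
    using adjoint_pair_mult[OF assms, of x "finv \<alpha>\<^sub>2 e"] by (simp add: right_unit)
  from *[of "finv \<alpha>\<^sub>1 e"] have "nucleus_element A = \<alpha>\<^sub>2 (B (finv \<alpha>\<^sub>2 e))"
    by (simp add: nucleus_element_def left_unit)
  with * show "ml (\<alpha>\<^sub>1 x) (nucleus_element A) = \<alpha>\<^sub>1 (A x)"
    by simp
  show "ml (nucleus_element A) (\<alpha>\<^sub>2 y) = \<alpha>\<^sub>2 (B y)"
    using adjoint_pair_mult[OF assms, of "finv \<alpha>\<^sub>1 e" y]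
    by (simp add: nucleus_element_def left_unit)
qed

lemma nucleus_element_in_middle_nucleus:
  assumes "adjoint_pair A B"
  shows "nucleus_element A \<in> middle_nucleus ml"
proof -
  have "ml x (ml (nucleus_element A) y) = ml (ml x (nucleus_element A)) y" for x y
    using adjoint_pair_mult[OF assms, of "finv \<alpha>\<^sub>1 x" "finv \<alpha>\<^sub>2 y"]
      nucleus_element_mult(1)[OF assms, of "finv \<alpha>\<^sub>1 x"]
      nucleus_element_mult(2)[OF assms, of "finv \<alpha>\<^sub>2 y"] by simp
  then show ?thesis
    unfolding middle_nucleus_def by blast
qed

lemma middle_nucleusE:
  assumes "u \<in> middle_nucleus ml"
  obtains A B where "adjoint_pair A B" "u = nucleus_element A"
proof
  show "adjoint_pair (\<lambda>x. finv \<alpha>\<^sub>1 (ml (\<alpha>\<^sub>1 x) u)) (\<lambda>y. finv \<alpha>\<^sub>2 (ml u (\<alpha>\<^sub>2 y)))"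
    using assms by (simp add: adjoint_pair_def middle_nucleusD flip: isotopy)
  show "u = nucleus_element (\<lambda>x. finv \<alpha>\<^sub>1 (ml (\<alpha>\<^sub>1 x) u))"
    by (simp add: nucleus_element_def left_unit)
qed

text \<open>In the semifield, the transported \<open>C\<close> satisfies
  \<open>(xu)y = C(xy)\<close>. Taking \<open>y = e\<close>, then \<open>x = e\<close>, identifies
  right and left multiplication by \<open>u\<close> with \<open>C\<close>, so the identity becomes
  \<open>(uy)w = u(yw)\<close>.\<close>

lemma nucleus_element_in_center:
  assumes "adjoint_pair A B" and C: "\<And>x y. g (A x) y = C (g x y)"
  shows "nucleus_element A \<in> semifield_center ml"
proof -
  let ?u = "nucleus_element A" and ?C = "\<lambda>z. finv \<beta> (C (\<beta> z))"
  have 1: "ml (ml x ?u) y = ?C (ml x y)" for x y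
  proof -
    have "\<beta> (ml (\<alpha>\<^sub>1 (A (finv \<alpha>\<^sub>1 x))) (\<alpha>\<^sub>2 (finv \<alpha>\<^sub>2 y))) = C (\<beta> (ml x y))"
      by (simp only: isotopy C) (simp flip: isotopy)
    then have "ml (\<alpha>\<^sub>1 (A (finv \<alpha>\<^sub>1 x))) y = ?C (ml x y)"
      by (metis inv_simps(2,6))
    then show ?thesis
      using nucleus_element_mult(1)[OF assms(1), of "finv \<alpha>\<^sub>1 x"] by simp
  qed
  have 2: "ml (ml x ?u) y = ml x (ml ?u y)" for x y
    by (rule middle_nucleusD[OF nucleus_element_in_middle_nucleus[OF assms(1)]])
  have 3: "ml x ?u = ?C x" for x
    using 1[of x e] by (simp add: right_unit)
  have 4: "ml ?u x = ?C x" for x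
    using 1[of e x] by (simp add: left_unit)
  show ?thesis
  proof (rule semifield_centerI)
    show "ml ?u y = ml y ?u" for y
      by (simp only: 3 4)
    show "ml (ml ?u y) w = ml ?u (ml y w)" for y w
      using 1[of y w] by (simp only: 3 4)
  qed (rule 2)
qed

text \<open>\<open>C\<close> is multiplication by the central element, conjugated by
  \<open>\<beta>\<close>.\<close>

lemma nucleus_element_centerD:
  assumes "adjoint_pair A B" "nucleus_element A \<in> semifield_center ml"
  shows "\<exists>C. \<forall>x y. g (A x) y = C (g x y)"
proof (intro exI allI)
  fix x y
  have "g (A x) y = \<beta> (ml (ml (\<alpha>\<^sub>1 x) (nucleus_element A)) (\<alpha>\<^sub>2 y))"
    by (simp add: isotopy nucleus_element_mult(1)[OF assms(1)])
  also have "\<dots> = \<beta> (ml (nucleus_element A) (ml (\<alpha>\<^sub>1 x) (\<alpha>\<^sub>2 y)))"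
    by (simp only: semifield_centerD(2)[OF assms(2)]
        flip: semifield_centerD(1)[OF assms(2), of "\<alpha>\<^sub>1 x"])
  also have "ml (\<alpha>\<^sub>1 x) (\<alpha>\<^sub>2 y) = finv \<beta> (g x y)"
    by (simp flip: isotopy)
  finally show "g (A x) y = \<beta> (ml (nucleus_element A) (finv \<beta> (g x y)))" .
qed

end

section \<open>Independence of characters\<close>

text \<open>Dedekind's argument: subtracting \<open>\<chi> j y\<close> times the relation at
  \<open>x\<close> from the relation at \<open>y * x\<close> eliminates \<open>\<chi> j\<close>,
  where \<open>y\<close> is chosen to separate \<open>\<chi> i\<close> from
  \<open>\<chi> j\<close>.\<close>

lemma characters_independent:
  fixes \<chi> :: "'i \<Rightarrow> 'a::monoid_mult \<Rightarrow> 'b::field"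
  assumes "finite I" "inj_on \<chi> I"
    and mult: "\<And>i x y. i \<in> I \<Longrightarrow> \<chi> i (x * y) = \<chi> i x * \<chi> i y"
    and one: "\<And>i. i \<in> I \<Longrightarrow> \<chi> i 1 = 1"
    and "\<And>x. (\<Sum>i\<in>I. c i * \<chi> i x) = 0" and "i \<in> I"
  shows "c i = 0"
  using assms
proof (induction I arbitrary: c i rule: finite_induct)
  case empty
  then show ?case by simp
next
  case (insert j F)
  have *: "c i = 0" if i: "i \<in> F" for i
  proof -
    have "\<chi> i \<noteq> \<chi> j"
      using i insert.hyps insert.prems(1) by (auto simp: inj_on_def)
    then obtain y where y: "\<chi> i y \<noteq> \<chi> j y"
      by blast
    have "(\<Sum>i\<in>F. (c i * (\<chi> i y - \<chi> j y)) * \<chi> i x) = 0" for x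
    proof -
      have "c j * (\<chi> j y * \<chi> j x) + (\<Sum>i\<in>F. c i * (\<chi> i y * \<chi> i x)) = 0"
        using insert.prems(4)[of "y * x"] insert.hyps insert.prems(2) by simp
      moreover have "\<chi> j y * (c j * \<chi> j x + (\<Sum>i\<in>F. c i * \<chi> i x)) = 0"
        using insert.prems(4)[of x] insert.hyps by simp
      ultimately show ?thesis
        by (simp add: algebra_simps sum_subtractf sum_distrib_left) (metis add_left_imp_eq)
    qed
    then have "c i * (\<chi> i y - \<chi> j y) = 0"
      using insert.IH[of "\<lambda>i. c i * (\<chi> i y - \<chi> j y)" i] insert.prems i by auto
    with y show ?thesis by simp
  qed
  have "c j = 0"
    using insert.prems(4)[of 1] insert.prems(3)[of j] insert.hyps * by simp
  with * insert.prems(5) show ?case by auto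
qed

section \<open>Semilinear maps of the plane in characteristic two\<close>

definition scale :: "'a::times \<Rightarrow> 'a \<times> 'a \<Rightarrow> 'a \<times> 'a" where
  "scale c x = (c * fst x, c * snd x)"

text \<open>The determinant, with a plus sign in view of characteristic two.\<close>

definition dt :: "'a::field \<times> 'a \<Rightarrow> 'a \<times> 'a \<Rightarrow> 'a" where
  "dt x y = fst x * snd y + snd x * fst y"

text \<open>For multiplicative \<open>\<sigma>\<close>, the product of the first \<open>i\<close>
  conjugates of \<open>c\<close>; if \<open>i\<close> is the order of \<open>\<sigma>\<close>, this
  is the norm to its fixed field.\<close>

primrec twisted_norm :: "('a::field \<Rightarrow> 'a) \<Rightarrow> nat \<Rightarrow> 'a \<Rightarrow> 'a" where
  "twisted_norm \<sigma> 0 c = 1"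
| "twisted_norm \<sigma> (Suc i) c = c * \<sigma> (twisted_norm \<sigma> i c)"

text \<open>\<open>w\<close> is the determinant of the matrix of \<open>T\<close>;
  \<open>l_not_power\<close> says that \<open>l\<close> is no quotient
  \<open>\<sigma> \<mu> / \<mu>\<close>.\<close>

locale semilinear_plane =
  fixes \<sigma> :: "'a::{finite, field} \<Rightarrow> 'a" and T :: "'a \<times> 'a \<Rightarrow> 'a \<times> 'a" and w l :: 'a
  assumes char2: "x + x = (0::'a)"
    and \<sigma>_add: "\<sigma> (x + y) = \<sigma> x + \<sigma> y"
    and \<sigma>_mult: "\<sigma> (x * y) = \<sigma> x * \<sigma> y"
    and \<sigma>_1: "\<sigma> 1 = 1"
    and \<sigma>_nontrivial: "\<exists>\<mu>. \<sigma> \<mu> \<noteq> \<mu>"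
    and \<sigma>_order: "\<exists>n>0. \<sigma> ^^ n = id"
    and T_add: "T (u + v) = T u + T v"
    and T_scale: "T (scale c u) = scale (\<sigma> c) (T u)"
    and dt_T: "dt (T u) (T v) = w * \<sigma> (dt u v)"
    and anisotropic: "dt u (T u) = 0 \<Longrightarrow> u = 0"
    and l_nonzero: "l \<noteq> 0"
    and l_not_power: "\<sigma> \<mu> + l * \<mu> = 0 \<Longrightarrow> \<mu> = 0"
begin

lemma char2_cancel: "x + (x + y) = (y::'a)"
  by (simp add: char2 flip: add.assoc)

lemma add_eq_0: "x + y = 0 \<longleftrightarrow> x = (y::'a)"
  by (metis add.right_neutral char2 char2_cancel)

lemma square_cancel: "x * x = y * y \<longleftrightarrow> x = (y::'a)"
proof
  assume "x * x = y * y"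
  then have "(x + y) * (x + y) = 0"
    by (simp add: algebra_simps char2 char2_cancel)
  then show "x = y"
    by (simp add: add_eq_0)
qed simp

lemma ex_square_root: "\<exists>r. r * r = (a::'a)"
proof -
  have "inj (\<lambda>x::'a. x * x)"
    by (simp add: inj_def square_cancel)
  then have "surj (\<lambda>x::'a. x * x)"
    by (rule finite_UNIV_inj_surj[OF finite])
  then show ?thesis
    by (metis surjD)
qed

lemma \<sigma>_0: "\<sigma> 0 = 0"
  by (metis \<sigma>_add add.right_neutral char2)

lemma \<sigma>_eq_0: "\<sigma> x = 0 \<longleftrightarrow> x = 0"
  by (metis \<sigma>_0 \<sigma>_1 \<sigma>_mult mult_zero_left right_inverse zero_neq_one)

lemma \<sigma>_inj: "\<sigma> x = \<sigma> y \<longleftrightarrow> x = y"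
  by (metis \<sigma>_add \<sigma>_eq_0 add_eq_0)

lemma scale_simps:
  "scale 0 u = 0" "scale 1 u = u" "scale c 0 = (0::'a \<times> 'a)"
  "scale c (scale d u) = scale (c * d) u"
  "scale c (u + v) = scale c u + scale c v" "scale (c + d) u = scale c u + scale d u"
  for u v :: "'a \<times> 'a"
  by (simp_all add: scale_def algebra_simps prod_eq_iff)

lemma dt_simps:
  "dt u u = 0" "dt 0 v = 0" "dt u 0 = 0"
  "dt (scale c u) v = c * dt u v" "dt u (scale c v) = c * dt u v"
  "dt (u + u') v = dt u v + dt u' v" "dt u (v + v') = dt u v + dt u v'"
  for u v u' v' :: "'a \<times> 'a"
  by (simp_all add: scale_def dt_def algebra_simps char2)

lemma dt_commute: "dt u v = dt v (u::'a \<times> 'a)"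
  by (simp add: dt_def algebra_simps)

lemma dt_eqI:
  assumes "\<And>y::'a \<times> 'a. dt u y = dt v y"
  shows "u = v"
  using assms[of "(0, 1)"] assms[of "(1, 0)"] by (simp add: dt_def prod_eq_iff)

text \<open>Cramer's rule with denominators cleared.\<close>

lemma pluecker: "scale (dt x u) v + scale (dt v x) u = scale (dt v u) (x :: 'a \<times> 'a)"
  by (simp add: prod_eq_iff scale_def dt_def algebra_simps char2 char2_cancel)

lemma basis_expansion:
  fixes x u v :: "'a \<times> 'a"
  assumes "dt v u \<noteq> 0"
  obtains a b where "x = scale a v + scale b u"
proof
  have "x = scale (inverse (dt v u)) (scale (dt v u) x)"
    using assms by (simp add: scale_simps)
  also have "\<dots> = scale (inverse (dt v u) * dt x u) v + scale (inverse (dt v u) * dt v x) u"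
    by (subst pluecker[symmetric]) (simp add: scale_simps)
  finally show "x = scale (inverse (dt v u) * dt x u) v + scale (inverse (dt v u) * dt v x) u" .
qed

lemma coefficients_unique:
  fixes u v :: "'a \<times> 'a"
  assumes "dt v u \<noteq> 0" "scale a v + scale b u = scale a' v + scale b' u"
  shows "a = a'" "b = b'"
  using arg_cong[OF assms(2), of "\<lambda>x. dt x u"] arg_cong[OF assms(2), of "dt v"] assms(1)
  by (simp_all add: dt_simps)

definition linear :: "('a \<times> 'a \<Rightarrow> 'a \<times> 'a) \<Rightarrow> bool" where
  "linear A \<longleftrightarrow> (\<forall>u v. A (u + v) = A u + A v) \<and> (\<forall>c u. A (scale c u) = scale c (A u))"

lemma linearD:
  assumes "linear A"
  shows "A (u + v) = A u + A v" "A (scale c u) = scale c (A u)"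
  using assms unfolding linear_def by blast+

lemma linear_eqI:
  assumes "linear A" "linear B" "dt v u \<noteq> 0" "A v = B v" "A u = B u"
  shows "A x = B x"
proof -
  obtain a b where "x = scale a v + scale b u"
    using basis_expansion[OF assms(3)] .
  then show ?thesis
    using assms(4,5) by (simp add: linearD[OF assms(1)] linearD[OF assms(2)])
qed

text \<open>The left side is an alternating bilinear form on a plane, hence a multiple of
  \<open>dt\<close>; the factor is the trace of \<open>A\<close>.\<close>

lemma ex_trace:
  assumes "linear A"
  shows "\<exists>\<tau>. \<forall>x y. dt (A x) y + dt x (A y) = \<tau> * dt x y"
proof (intro exI allI)
  fix x y :: "'a \<times> 'a"
  let ?e1 = "(1, 0) :: 'a \<times> 'a" and ?e2 = "(0, 1) :: 'a \<times> 'a"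
  have A: "A z = scale (fst z) (A ?e1) + scale (snd z) (A ?e2)" for z
  proof -
    have "z = scale (fst z) ?e1 + scale (snd z) ?e2"
      by (simp add: scale_def prod_eq_iff)
    then show ?thesis
      using assms unfolding linear_def by metis
  qed
  show "dt (A x) y + dt x (A y) = (dt (A ?e1) ?e2 + dt ?e1 (A ?e2)) * dt x y"
    by (subst A[of x], subst A[of y])
      (simp add: scale_def dt_def algebra_simps char2 char2_cancel)
qed

subsection \<open>The power of the semilinear map that is linear\<close>

definition n :: nat where
  "n = (LEAST n. 0 < n \<and> \<sigma> ^^ n = id)"

definition N :: "'a \<times> 'a \<Rightarrow> 'a \<times> 'a" where
  "N = T ^^ n"

lemma n_pos: "0 < n" and \<sigma>_n: "\<sigma> ^^ n = id"
  using LeastI_ex[OF \<sigma>_order] by (simp_all add: n_def)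

lemma \<sigma>_less_n: "0 < i \<Longrightarrow> i < n \<Longrightarrow> \<sigma> ^^ i \<noteq> id"
  using not_less_Least unfolding n_def by blast

lemma \<sigma>_pow_mult: "(\<sigma> ^^ i) (x * y) = (\<sigma> ^^ i) x * (\<sigma> ^^ i) y"
  by (induction i) (simp_all add: \<sigma>_mult)

lemma \<sigma>_pow_1: "(\<sigma> ^^ i) 1 = 1"
  by (induction i) (simp_all add: \<sigma>_1)

lemma inj_\<sigma>_pow: "inj_on (\<lambda>i. \<sigma> ^^ i) {..<n}"
proof (rule linorder_inj_onI)
  fix i j assume ij: "i < j" "i \<in> {..<n}" "j \<in> {..<n}"
  show "\<sigma> ^^ i \<noteq> \<sigma> ^^ j"
  proof
    assume eq: "\<sigma> ^^ i = \<sigma> ^^ j"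
    have "\<sigma> ^^ j = \<sigma> ^^ i \<circ> \<sigma> ^^ (j - i)"
      using ij(1) by (simp flip: funpow_add)
    moreover have "inj (\<sigma> ^^ i)"
      by (rule inj_fn) (simp add: inj_def \<sigma>_inj)
    ultimately have "\<sigma> ^^ (j - i) = id"
      using eq by (auto simp: fun_eq_iff inj_def)
    then show False
      using \<sigma>_less_n[of "j - i"] ij by (simp add: less_imp_diff_less)
  qed
qed auto

lemma T_pow_add: "(T ^^ i) (u + v) = (T ^^ i) u + (T ^^ i) v"
  by (induction i) (simp_all add: T_add)

lemma T_pow_scale: "(T ^^ i) (scale c u) = scale ((\<sigma> ^^ i) c) ((T ^^ i) u)"
  by (induction i) (simp_all add: T_scale)

lemma linear_N: "linear N"
  by (simp add: linear_def N_def T_pow_add T_pow_scale \<sigma>_n)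

lemma N_T: "N (T u) = T (N u)"
  by (simp add: N_def funpow_swap1)

lemma dt_T_pow: "dt ((T ^^ i) u) ((T ^^ i) v) = twisted_norm \<sigma> i w * (\<sigma> ^^ i) (dt u v)"
  by (induction i) (simp_all add: dt_T \<sigma>_mult)

lemma twisted_norm_mult: "twisted_norm \<sigma> i (a * b) = twisted_norm \<sigma> i a * twisted_norm \<sigma> i b"
  by (induction i) (simp_all add: \<sigma>_mult)

lemma twisted_norm_1: "twisted_norm \<sigma> i 1 = 1"
  by (induction i) (simp_all add: \<sigma>_1)

text \<open>If \<open>w = 0\<close>, anisotropy at \<open>T u\<close> gives \<open>T u = 0\<close>
  for all \<open>u\<close>, and then anisotropy kills every vector.\<close>

lemma w_nonzero: "w \<noteq> 0"
proof
  assume "w = 0"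
  then have "dt (T u) (T (T u)) = 0" for u
    using dt_T by simp
  then have T: "T u = 0" for u
    using anisotropic by blast
  have "(1, 0) = (0 :: 'a \<times> 'a)"
    by (rule anisotropic) (simp add: T dt_simps)
  then show False
    by (simp add: prod_eq_iff)
qed

text \<open>If \<open>N\<close> were a scalar \<open>\<nu>\<close>, determinants would give \<open>\<nu>\<^sup>2\<close> as the norm of
  \<open>w = r\<^sup>2\<close>, so \<open>\<nu>\<close> would be the norm of \<open>r\<close> and \<open>S = r\<^sup>-\<^sup>1T\<close> would satisfy
  \<open>S\<^sup>n = 1\<close>. Hilbert 90 for \<open>S\<close> then yields a nonzero fixed vector of \<open>S\<close>, which contradicts
  anisotropy.\<close>

lemma N_not_scalar: "\<exists>v. dt v (N v) \<noteq> 0"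
proof (rule ccontr)
  assume "\<nexists>v. dt v (N v) \<noteq> 0"
  then have iso: "dt v (N v) = 0" for v
    by blast
  let ?e1 = "(1, 0) :: 'a \<times> 'a" and ?e2 = "(0, 1) :: 'a \<times> 'a"
  define \<nu> where "\<nu> = fst (N ?e1)"
  have N1: "N ?e1 = scale \<nu> ?e1"
    using iso[of ?e1] by (simp add: dt_def \<nu>_def scale_def prod_eq_iff)
  \<comment> \<open>Both basis vectors are eigenvectors; their sum being one too forces equal
    eigenvalues.\<close>
  have "N (?e1 + ?e2) = N ?e1 + N ?e2"
    using linear_N unfolding linear_def by blast
  then have N2: "N ?e2 = scale \<nu> ?e2"
    using iso[of ?e2] iso[of "?e1 + ?e2"] N1
    by (simp add: dt_def scale_def prod_eq_iff add_eq_0)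
  have N: "N x = scale \<nu> x" for x
  proof (rule linear_eqI[OF linear_N _ _ N1 N2])
    show "linear (scale \<nu>)"
      by (simp add: linear_def scale_simps mult.commute)
    show "dt ?e1 ?e2 \<noteq> 0"
      by (simp add: dt_def)
  qed
  obtain r where r: "r * r = w"
    using ex_square_root by blast
  have r0: "r \<noteq> 0"
    using r w_nonzero by auto
  have "\<nu> * \<nu> = twisted_norm \<sigma> n w"
    using dt_T_pow[of n ?e1 ?e2] N[unfolded N_def] by (simp add: dt_simps \<sigma>_n) (simp add: dt_def)
  then have \<nu>: "twisted_norm \<sigma> n r = \<nu>"
    by (simp add: square_cancel twisted_norm_mult flip: r)
  define S where "S u = scale (inverse r) (T u)" for u
  have S_pow: "(S ^^ i) u = scale (twisted_norm \<sigma> i (inverse r)) ((T ^^ i) u)" for i u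
    by (induction i) (simp_all add: S_def T_scale scale_simps)
  have "twisted_norm \<sigma> n (inverse r) * \<nu> = 1"
    using r0 by (simp add: twisted_norm_1 flip: \<nu> twisted_norm_mult)
  then have S_n: "(S ^^ n) u = u" for u
    using N[unfolded N_def] by (simp add: S_pow scale_simps)
  \<comment> \<open>Since \<open>S ^^ n\<close> is the identity, the orbit sum \<open>P u\<close> is
    fixed by \<open>S\<close>, so \<open>T\<close> maps it to a multiple of itself and anisotropy
    gives \<open>P u = 0\<close>.\<close>
  define P where "P u = (\<Sum>i<n. (S ^^ i) u)" for u
  interpret S: Modules.additive S
    by standard (simp add: S_def T_add scale_simps)
  have "S (P u) = P u" for u
  proof -
    have "S (P u) + u = (\<Sum>i<n. (S ^^ Suc i) u) + (S ^^ 0) u"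
      by (simp add: P_def S.sum)
    also have "\<dots> = (\<Sum>i<Suc n. (S ^^ i) u)"
      by (simp only: sum.lessThan_Suc_shift add.commute)
    also have "\<dots> = P u + u"
      by (simp add: P_def S_n)
    finally show ?thesis
      by simp
  qed
  then have "dt (P u) (S (P u)) = 0" for u
    by (simp add: dt_simps)
  then have "dt (P u) (T (P u)) = 0" for u
    using r0 by (simp add: S_def dt_simps)
  then have P: "P u = 0" for u
    by (rule anisotropic)
  have S_pow_scale: "(S ^^ i) (scale c u) = scale ((\<sigma> ^^ i) c) ((S ^^ i) u)" for i c u
    by (simp add: S_pow T_pow_scale scale_simps mult.commute)
  \<comment> \<open>The vanishing of \<open>P\<close> on the line through \<open>?e1\<close> is a
    relation between the characters \<open>\<sigma> ^^ i\<close> with coefficient 1 at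
    \<open>i = 0\<close>.\<close>
  have "(\<Sum>i<n. fst ((S ^^ i) ?e1) * (\<sigma> ^^ i) c) = 0" for c
  proof -
    have "fst (P (scale c ?e1)) = 0"
      by (simp add: P)
    then show ?thesis
      unfolding P_def S_pow_scale fst_sum by (simp add: scale_def mult.commute)
  qed
  then have "fst ((S ^^ 0) ?e1) = 0"
    using n_pos
    by (intro characters_independent[of "{..<n}" "\<lambda>i. \<sigma> ^^ i" "\<lambda>i. fst ((S ^^ i) ?e1)" 0])
      (simp_all add: inj_\<sigma>_pow \<sigma>_pow_mult \<sigma>_pow_1)
  then show False
    by simp
qed

text \<open>\<open>A\<close> commutes with \<open>N\<close>, so it is determined by
  \<open>A v\<close> expanded in the basis \<open>v\<close>, \<open>N v\<close>. Commuting with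
  \<open>T\<close> and comparing coefficients at the independent vectors \<open>T v\<close>,
  \<open>T (N v)\<close> makes \<open>a\<close> and \<open>b\<close> fixed.\<close>

lemma commutant_T:
  assumes lin: "linear A" and comm: "\<And>x. A (T x) = T (A x)"
  obtains a b where "\<sigma> a = a" "\<sigma> b = b" "\<And>x. A x = scale a x + scale b (N x)"
proof -
  obtain v where v: "dt v (N v) \<noteq> 0"
    using N_not_scalar by blast
  obtain a b where ab: "A v = scale a v + scale b (N v)"
    using basis_expansion[OF v] .
  have "A ((T ^^ i) x) = (T ^^ i) (A x)" for i x
    by (induction i) (simp_all add: comm)
  then have AN: "A (N x) = N (A x)" for x
    by (simp add: N_def)
  have linX: "linear (\<lambda>x. scale a x + scale b (N x))"
    unfolding linear_def by (simp add: linearD[OF linear_N] scale_simps algebra_simps)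
  have A: "A x = scale a x + scale b (N x)" for x
  proof (rule linear_eqI[OF lin linX v ab])
    show "A (N v) = scale a (N v) + scale b (N (N v))"
      by (simp add: AN ab linearD[OF linear_N])
  qed
  have "scale (\<sigma> a) (T v) + scale (\<sigma> b) (T (N v)) = scale a (T v) + scale b (T (N v))"
    using comm[of v] by (simp add: A T_add T_scale N_T)
  moreover have "dt (T v) (T (N v)) \<noteq> 0"
    using v by (simp add: dt_T w_nonzero \<sigma>_eq_0)
  ultimately have "\<sigma> a = a" "\<sigma> b = b"
    using coefficients_unique by blast+
  with A that show ?thesis
    by blast
qed

subsection \<open>The presemifield of the semilinear map\<close>

definition pm :: "'a \<times> 'a \<Rightarrow> 'a \<times> 'a \<Rightarrow> 'a \<times> 'a" where
  "pm x y = (dt x (T y) + l * dt y (T x), dt x y)"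

lemma adjoint_linear:
  assumes "\<And>x y. dt (A x) y = dt x (B y)"
  shows "linear A"
  unfolding linear_def by (intro conjI allI; rule dt_eqI) (simp_all add: assms dt_simps)

text \<open>Replacing \<open>x\<close> by \<open>scale c x\<close> multiplies one part of the first
  coordinate by \<open>c\<close> and the other by \<open>\<sigma> c\<close>; the cases
  \<open>c = 1\<close> and \<open>c = \<mu>\<close> separate the parts.\<close>

lemma pm_adjoint_commutes:
  assumes adj: "\<And>x y. pm (A x) y = pm x (B y)"
  shows "linear A" "A (T x) = T (A x)"
proof -
  have dt: "dt (A x) y = dt x (B y)" for x y
    using adj[of x y] by (simp add: pm_def)
  then show lin: "linear A"
    by (rule adjoint_linear)
  obtain \<mu> where \<mu>: "\<sigma> \<mu> \<noteq> \<mu>"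
    using \<sigma>_nontrivial by blast
  show "A (T x) = T (A x)"
  proof (rule dt_eqI)
    fix y
    define P P' Q Q' where "P = dt (A x) (T y)" and "P' = dt x (T (B y))"
      and "Q = dt (T (A x)) y" and "Q' = dt (A (T x)) y"
    have eq: "c * P + l * (\<sigma> c * Q) = c * P' + l * (\<sigma> c * Q')" for c
    proof -
      have "fst (pm (A (scale c x)) y) = fst (pm (scale c x) (B y))"
        by (simp add: adj)
      moreover have "A (scale c x) = scale c (A x)"
        by (rule linearD[OF lin])
      ultimately show ?thesis
        by (simp add: pm_def dt_simps T_scale P_def P'_def Q_def Q'_def dt dt_commute[of y]
            dt_commute[of "B y"])
    qed
    have "P - P' = l * (Q' - Q)"
      using eq[of 1] by (simp add: \<sigma>_1 algebra_simps)
    moreover have "\<mu> * (P - P') = \<sigma> \<mu> * (l * (Q' - Q))"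
      using eq[of \<mu>] by (simp add: algebra_simps)
    ultimately have "\<mu> * (l * (Q' - Q)) = \<sigma> \<mu> * (l * (Q' - Q))"
      by simp
    then have "Q' = Q"
      using \<mu> l_nonzero by simp
    then show "dt (A (T x)) y = dt (T (A x)) y"
      by (simp add: Q_def Q'_def)
  qed
qed

text \<open>The \<open>dt\<close>-adjoint of \<open>N\<close> is \<open>\<tau> + N\<close> with
  \<open>\<tau>\<close> the trace. It preserves the first coordinate relation too because
  \<open>\<tau>\<close> is fixed by \<open>\<sigma>\<close>, so that \<open>B\<close> commutes with
  \<open>T\<close>.\<close>

lemma pm_adjoint_exists:
  assumes "\<sigma> a = a" "\<sigma> b = b"
  shows "\<exists>B. \<forall>x y. pm (scale a x + scale b (N x)) y = pm x (B y)"
proof -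
  obtain \<tau> where \<tau>: "dt (N x) y + dt x (N y) = \<tau> * dt x y" for x y
    using ex_trace[OF linear_N] by blast
  \<comment> \<open>The trace identity is evaluated at the images \<open>T ?e1\<close>,
    \<open>T ?e2\<close>, past which \<open>N\<close> commutes.\<close>
  have "w * \<sigma> \<tau> = \<tau> * w"
  proof -
    let ?e1 = "(1, 0) :: 'a \<times> 'a" and ?e2 = "(0, 1) :: 'a \<times> 'a"
    have "\<tau> * dt (T ?e1) (T ?e2) = dt (N (T ?e1)) (T ?e2) + dt (T ?e1) (N (T ?e2))"
      by (simp only: \<tau>)
    also have "\<dots> = w * \<sigma> (dt (N ?e1) ?e2 + dt ?e1 (N ?e2))"
      by (simp add: N_T dt_T \<sigma>_add distrib_left)
    finally have "\<tau> * dt (T ?e1) (T ?e2) = w * \<sigma> (dt (N ?e1) ?e2 + dt ?e1 (N ?e2))" .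
    then show ?thesis
      by (simp add: \<tau> dt_T) (auto simp: dt_def \<sigma>_1)
  qed
  then have \<sigma>\<tau>: "\<sigma> \<tau> = \<tau>"
    using w_nonzero by auto
  define A where "A x = scale a x + scale b (N x)" for x
  define B where "B y = scale (a + b * \<tau>) y + scale b (N y)" for y
  have "dt (N x) y = \<tau> * dt x y + dt x (N y)" for x y
    by (simp add: add.assoc char2 flip: \<tau>)
  then have adj: "dt (A x) y = dt x (B y)" for x y
    by (simp add: A_def B_def dt_simps algebra_simps)
  have TA: "T (A x) = A (T x)" for x
    by (simp add: A_def T_add T_scale assms N_T)
  have TB: "T (B x) = B (T x)" for x
    by (simp add: B_def T_add T_scale assms N_T \<sigma>_add \<sigma>_mult \<sigma>\<tau>)
  have "pm (A x) y = pm x (B y)" for x y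
    by (simp add: pm_def TA TB adj dt_commute[of y] dt_commute[of "B y"])
  then show ?thesis
    unfolding A_def by blast
qed

lemma pm_scale_fixed:
  assumes "\<sigma> c = c"
  shows "pm (scale c x) y = scale c (pm x y)" "pm x (scale c y) = scale c (pm x y)"
  by (simp_all add: pm_def dt_simps T_scale assms) (simp_all add: scale_def algebra_simps)

text \<open>Along a line \<open>y = tx\<close> the product lies in the first coordinate, so a companion map
  \<open>C\<close> of \<open>N\<close> would have to send \<open>(\<sigma> t + l t)q\<close> to \<open>t\<delta>\<close>. Rescaling \<open>x\<close> by \<open>\<mu>\<close> shows that this is
  consistent only if \<open>\<mu>\<close> is fixed by \<open>\<sigma>\<close>.\<close>

lemma N_not_central: "\<nexists>C. \<forall>x y. pm (N x) y = C (pm x y)"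
proof
  assume "\<exists>C. \<forall>x y. pm (N x) y = C (pm x y)"
  then obtain C where C: "pm (N x) y = C (pm x y)" for x y
    by blast
  obtain v where v: "dt v (N v) \<noteq> 0"
    using N_not_scalar by blast
  obtain \<mu> where \<mu>: "\<sigma> \<mu> \<noteq> \<mu>"
    using \<sigma>_nontrivial by blast
  define q where "q = dt v (T v)"
  define \<delta> where "\<delta> = dt v (N v)"
  have key: "\<kappa> * t * \<delta> = snd (C ((\<kappa> * \<sigma> t + l * (t * \<sigma> \<kappa>)) * q, 0))" for \<kappa> t
  proof -
    have "N (scale \<kappa> v) = scale \<kappa> (N v)"
      by (rule linearD[OF linear_N])
    then have "\<kappa> * t * \<delta> = snd (pm (N (scale \<kappa> v)) (scale t v))"
      by (simp add: pm_def dt_simps \<delta>_def dt_commute[of "N v"] mult.commute)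
    also have "pm (scale \<kappa> v) (scale t v) = ((\<kappa> * \<sigma> t + l * (t * \<sigma> \<kappa>)) * q, 0)"
      by (simp add: pm_def dt_simps T_scale q_def algebra_simps)
    then have "snd (pm (N (scale \<kappa> v)) (scale t v)) =
        snd (C ((\<kappa> * \<sigma> t + l * (t * \<sigma> \<kappa>)) * q, 0))"
      by (simp add: C)
    finally show ?thesis .
  qed
  let ?h = "\<lambda> t. \<sigma> t + l * t"
  have "inj ?h"
  proof (rule injI)
    fix x y assume "?h x = ?h y"
    then have "?h (x + y) = 0"
      by (simp add: \<sigma>_add algebra_simps add_eq_0) (metis add_eq_0 add.assoc add.commute)
    then show "x = y"
      using l_not_power add_eq_0 by blast
  qed
  then have "surj ?h"
    by (rule finite_UNIV_inj_surj[OF finite])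
  \<comment> \<open>\<open>t\<close> is chosen so that \<open>key\<close> at \<open>(1, t)\<close>
    and at \<open>(\<mu>, \<mu>)\<close> has the same argument of \<open>C\<close>, which forces
    \<open>t = \<mu> * \<mu>\<close>.\<close>
  then obtain t where t: "\<mu> * \<sigma> \<mu> + l * (\<mu> * \<sigma> \<mu>) = ?h t"
    by (rule surjE)
  have "t * \<delta> = \<mu> * \<mu> * \<delta>"
    using key[of 1 t] key[of \<mu> \<mu>] t by (simp add: \<sigma>_1)
  then have "t = \<mu> * \<mu>"
    using v by (simp add: \<delta>_def)
  then have eq: "\<mu> * \<sigma> \<mu> + l * (\<mu> * \<sigma> \<mu>) = \<sigma> \<mu> * \<sigma> \<mu> + l * (\<mu> * \<mu>)"
    using t by (simp add: \<sigma>_mult)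
  have "?h \<mu> * (\<mu> + \<sigma> \<mu>) =
      (\<mu> * \<sigma> \<mu> + l * (\<mu> * \<sigma> \<mu>)) + (\<sigma> \<mu> * \<sigma> \<mu> + l * (\<mu> * \<mu>))"
    by (simp add: algebra_simps)
  also have "\<dots> = 0"
    by (simp only: eq char2)
  finally have "?h \<mu> * (\<mu> + \<sigma> \<mu>) = 0" .
  then have "\<mu> = 0 \<or> \<sigma> \<mu> = \<mu>"
    using l_not_power[of \<mu>] add_eq_0[of \<mu> "\<sigma> \<mu>"] by auto
  with \<mu> \<sigma>_0 show False
    by auto
qed

end

section \<open>The nuclei of the isotopes\<close>

text \<open>The generator is the nucleus element of \<open>N\<close>; its coefficients over the
  center come from scalars fixed by \<open>\<sigma>\<close>.\<close>

lemma quadratic_extension_isotope: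
  assumes "semilinear_plane \<sigma> T w l"
    and "semifield_isotopy ml e (semilinear_plane.pm T l) \<alpha>\<^sub>1 \<alpha>\<^sub>2 \<beta>"
    and "additive \<alpha>\<^sub>1"
  shows "quadratic_extension (middle_nucleus_ring ml e) (semifield_center ml)"
proof -
  interpret P: semilinear_plane \<sigma> T w l
    by fact
  interpret I: semifield_isotopy ml e P.pm \<alpha>\<^sub>1 \<alpha>\<^sub>2 \<beta>
    by fact
  have scale_center: "I.nucleus_element (scale c) \<in> semifield_center ml" if "\<sigma> c = c" for c
    by (rule I.nucleus_element_in_center[of _ "scale c" "scale c"])
      (simp_all add: I.adjoint_pair_def P.pm_scale_fixed[OF that])
  obtain B where B: "I.adjoint_pair P.N B"
    using P.pm_adjoint_exists[of 0 1]
    by (auto simp: I.adjoint_pair_def P.scale_simps P.\<sigma>_0 P.\<sigma>_1)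
  show ?thesis
  proof (rule I.quadratic_extension_middle_nucleus)
    show "I.nucleus_element P.N \<in> middle_nucleus ml"
      by (rule I.nucleus_element_in_middle_nucleus[OF B])
    show "I.nucleus_element P.N \<notin> semifield_center ml"
      using I.nucleus_element_centerD[OF B] P.N_not_central by blast
  next
    fix u assume "u \<in> middle_nucleus ml"
    then obtain A A' where A: "I.adjoint_pair A A'" "u = I.nucleus_element A"
      by (rule I.middle_nucleusE)
    have adj: "P.pm (A x) y = P.pm x (A' y)" for x y
      using A(1) unfolding I.adjoint_pair_def by blast
    obtain a b where ab: "\<sigma> a = a" "\<sigma> b = b" "\<And>x. A x = scale a x + scale b (P.N x)"
      using P.commutant_T[OF P.pm_adjoint_commutes[OF adj]] by blast
    have "ml (I.nucleus_element (scale b)) (I.nucleus_element P.N) =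
        \<alpha>\<^sub>1 (scale b (P.N (finv \<alpha>\<^sub>1 e)))"
      using I.nucleus_element_mult(1)[OF B, of "scale b (finv \<alpha>\<^sub>1 e)"]
      by (simp add: I.nucleus_element_def P.linearD[OF P.linear_N])
    then have "u = ml (I.nucleus_element (scale b)) (I.nucleus_element P.N)
        + I.nucleus_element (scale a)"
      by (simp add: A(2) ab(3) additive.add[OF assms(3)] add.commute I.nucleus_element_def)
    then show "\<exists>z1\<in>semifield_center ml. \<exists>z2\<in>semifield_center ml.
        u = ml z1 (I.nucleus_element P.N) + z2"
      using scale_center ab(1,2) by blast
  qed
qed

section \<open>Power maps on a finite field\<close>

lemma of_nat_CARD_eq_0: "of_nat CARD('a) = (0 :: 'a :: {finite, ring_1})"
proof -
  \<comment> \<open>Translation by 1 permutes the summands.\<close>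
  have "(\<Sum>x\<in>UNIV. x + 1) = (\<Sum>x\<in>UNIV. x :: 'a)"
    by (rule sum.reindex_bij_witness[of _ "\<lambda>x. x - 1" "\<lambda>x. x + 1"]) auto
  then show ?thesis
    by (simp add: sum.distrib)
qed

lemma power_CARD_eq_self: "x ^ CARD('a) = (x :: 'a :: {finite, field})"
proof (cases "x = 0")
  case False
  have "(\<Prod>y\<in>UNIV - {0}. x * y) = \<Prod>(UNIV - {0})"
    by (rule prod.reindex_bij_witness[of _ "\<lambda>y. y / x" "\<lambda>y. x * y"]) (use False in auto)
  then have "x ^ (CARD('a) - 1) = 1"
    by (simp add: prod.distrib)
  then show ?thesis
    by (metis mult.right_neutral power_minus_mult zero_less_card_finite mult.commute)
qed (simp add: zero_power)

lemma power_not_identity: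
  assumes "1 < k" "k < CARD('a)"
  shows "\<exists>x :: 'a :: {finite, field}. x ^ k \<noteq> x"
proof (rule ccontr)
  assume *: "\<not> ?thesis"
  \<comment> \<open>All field elements would be roots of a nonzero polynomial of degree at most
    \<open>k\<close>.\<close>
  let ?p = "Polynomial.monom 1 k - Polynomial.monom 1 1 :: 'a poly"
  have "Polynomial.coeff ?p k = 1"
    using assms(1) by simp
  then have "?p \<noteq> 0"
    by (metis Polynomial.coeff_0 zero_neq_one)
  then have "card {x. poly ?p x = 0} \<le> degree ?p"
    by (rule card_poly_roots_bound)
  also have "\<dots> \<le> k"
    using assms(1) by (intro degree_diff_le) (auto intro: order.trans[OF degree_monom_le])
  finally show False
    using * assms(2) by (simp add: poly_monom)
qed

theorem theorem9:
  fixes m s :: nat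
    and l :: "'a::{finite, field}"
    and t :: "'a \<times> 'a \<times> 'a \<times> 'a"
    and S :: "'b::{finite, ab_group_add} \<Rightarrow> 'b \<Rightarrow> 'b"
    and e :: 'b
  assumes "1 \<le> m" and "CARD('a) = 2 ^ m"
    and "0 < s" and "s < 2 * m" and "s \<noteq> m"
    and "legitimate s t"
    and "l \<noteq> 0" and "l \<notin> unit_powers (2 ^ s - 1)"
    and "finite_semifield S e"
    and "isotopic S (B_mult s l t)"
  shows "quadratic_extension (middle_nucleus_ring S e) (semifield_center S)"
proof -
  define \<sigma> :: "'a \<Rightarrow> 'a" where "\<sigma> x = x ^ 2 ^ s" for x
  obtain p1 p2 p3 p4 where t: "t = (p1, p2, p3, p4)"
    by (cases t)
  \<comment> \<open>The entries are read off from the product: \<open>dt x (T y)\<close> collects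
    its terms without \<open>l\<close>.\<close>
  define T where "T u = (p2 * \<sigma> (fst u) + p4 * \<sigma> (snd u), p1 * \<sigma> (fst u) + p3 * \<sigma> (snd u))" for u
  have "(2::'a) = 0"
    using of_nat_CARD_eq_0[where 'a = 'a] by (simp add: assms(2))
  then have char2: "x + x = 0" for x :: 'a
    by (simp flip: mult_2)
  have char2': "x + (x + y) = y" for x y :: 'a
    by (simp add: char2 flip: add.assoc)
  have frobenius: "(x + y) ^ 2 ^ k = x ^ 2 ^ k + y ^ 2 ^ k" for x y :: 'a and k
  proof (induction k)
    case (Suc k)
    have "(x + y) ^ 2 ^ Suc k = ((x + y) ^ 2 ^ k)\<^sup>2"
      by (simp add: mult.commute flip: power_mult)
    also have "\<dots> = (x ^ 2 ^ k)\<^sup>2 + (y ^ 2 ^ k)\<^sup>2"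
      by (simp add: Suc power2_sum \<open>(2::'a) = 0\<close>)
    also have "\<dots> = x ^ 2 ^ Suc k + y ^ 2 ^ Suc k"
      by (simp add: mult.commute flip: power_mult)
    finally show ?case .
  qed simp
  have power_q: "x ^ 2 ^ m = x" for x :: 'a
    using power_CARD_eq_self[of x] by (simp add: assms(2))
  have \<sigma>_nontrivial: "\<exists>\<mu>. \<sigma> \<mu> \<noteq> \<mu>"
  proof (cases "s < m")
    case True
    then show ?thesis
      using power_not_identity[of "2 ^ s", where 'a = 'a] assms(2,3) one_less_power[of "2::nat" s]
      by (simp add: \<sigma>_def)
  next
    case False
    \<comment> \<open>The map \<open>x ^ 2 ^ m\<close> is the identity, so \<open>s\<close> may be
      reduced by \<open>m\<close>.\<close>
    with assms(4,5) have sm: "0 < s - m" "s - m < m" "s = m + (s - m)"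
      by auto
    have "\<sigma> x = x ^ 2 ^ (s - m)" for x
      unfolding \<sigma>_def by (subst sm(3)) (simp add: power_add power_mult power_q)
    then show ?thesis
      using power_not_identity[of "2 ^ (s - m)", where 'a = 'a] assms(2) sm(1,2)
        one_less_power[of "2::nat" "s - m"] by simp
  qed
  have \<sigma>_pow: "(\<sigma> ^^ i) x = x ^ (2 ^ s) ^ i" for i x
    by (induction i) (simp_all add: \<sigma>_def mult.commute flip: power_mult)
  have power_q': "x ^ (2 ^ m) ^ i = x" for x :: 'a and i
    by (induction i) (simp_all add: power_mult power_q)
  have \<sigma>_order: "\<sigma> ^^ m = id"
    using power_q'[of _ s] by (auto simp: \<sigma>_pow mult.commute simp flip: power_mult)
  have \<sigma>_mult: "\<sigma> (x * y) = \<sigma> x * \<sigma> y" for x y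
    by (simp add: \<sigma>_def power_mult_distrib)
  have \<sigma>_add: "\<sigma> (x + y) = \<sigma> x + \<sigma> y" for x y
    by (simp add: \<sigma>_def frobenius)
  have no_root: "p1 * (\<sigma> z * z) + p2 * \<sigma> z + p3 * z + p4 \<noteq> 0" and p1: "p1 \<noteq> 0" for z
    using assms(6) by (auto simp: t legitimate_def \<sigma>_def Let_def mult.commute)
  have plane: "semilinear_plane \<sigma> T (p1 * p4 + p2 * p3) l"
  proof
    show "\<exists>n>0. \<sigma> ^^ n = id"
      using \<sigma>_order assms(1) by (intro exI[of _ m]) simp
    show "\<sigma> 1 = 1"
      by (simp add: \<sigma>_def)
    show "T (u + v) = T u + T v" for u v
      by (simp add: T_def \<sigma>_add algebra_simps)
    show "T (scale c u) = scale (\<sigma> c) (T u)" for c u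
      by (simp add: T_def \<sigma>_mult scale_def algebra_simps)
    show "dt (T u) (T v) = (p1 * p4 + p2 * p3) * \<sigma> (dt u v)" for u v
      by (simp add: T_def dt_def \<sigma>_mult \<sigma>_add algebra_simps char2 char2')
    show "u = 0" if "dt u (T u) = 0" for u
    proof -
      obtain a b where u: "u = (a, b)"
        by (cases u)
      have eq: "p1 * (\<sigma> a * a) + p2 * (\<sigma> a * b) + p3 * (a * \<sigma> b) + p4 * (\<sigma> b * b) = 0"
        using that by (simp add: u dt_def T_def algebra_simps)
      have "b = 0"
      proof (rule ccontr)
        assume b: "b \<noteq> 0"
        \<comment> \<open>\<open>dt u (T u)\<close> is the homogenized polynomial of
          \<open>t\<close>, so \<open>z\<close> would be a root; for \<open>b = 0\<close> only the
          term with \<open>p1\<close> survives.\<close>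
        define z where "z = a / b"
        have a: "a = z * b"
          using b by (simp add: z_def)
        have "(p1 * (\<sigma> z * z) + p2 * \<sigma> z + p3 * z + p4) * (\<sigma> b * b) = 0"
          using eq unfolding a \<sigma>_mult by (simp add: algebra_simps)
        then show False
          using no_root b by (simp add: \<sigma>_def)
      qed
      moreover from this have "a = 0"
        using eq p1 by (simp add: \<sigma>_def power_0_left)
      ultimately show ?thesis
        by (simp add: u zero_prod_def)
    qed
    show "\<mu> = 0" if "\<sigma> \<mu> + l * \<mu> = 0" for \<mu>
    proof (rule ccontr)
      assume \<mu>: "\<mu> \<noteq> 0"
      have "\<sigma> \<mu> = l * \<mu>"
        using that by (metis add.right_neutral char2 char2')
      moreover have "\<sigma> \<mu> = \<mu> ^ (2 ^ s - 1) * \<mu>"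
        unfolding \<sigma>_def by (rule power_minus_mult[symmetric]) simp
      ultimately have "l = \<mu> ^ (2 ^ s - 1)"
        using \<mu> by simp
      with \<mu> assms(8) show False
        by (auto simp: unit_powers_def)
    qed
  qed (fact char2 \<sigma>_add \<sigma>_mult \<sigma>_nontrivial assms(7))+
  have pm: "semilinear_plane.pm T l x y = B_mult s l t x y" for x y
    by (cases x; cases y) (simp add: semilinear_plane.pm_def[OF plane] t B_mult_def Let_def
        dt_def T_def \<sigma>_def algebra_simps)
  obtain \<alpha>\<^sub>1 \<alpha>\<^sub>2 \<beta> where iso: "additive \<alpha>\<^sub>1" "bij \<alpha>\<^sub>1" "bij \<alpha>\<^sub>2" "bij \<beta>"
    "\<And>x y. \<beta> (S (\<alpha>\<^sub>1 x) (\<alpha>\<^sub>2 y)) = B_mult s l t x y"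
    using assms(10) unfolding isotopic_def by blast
  have "semifield_isotopy S e (semilinear_plane.pm T l) \<alpha>\<^sub>1 \<alpha>\<^sub>2 \<beta>"
    by (intro semifield_isotopy.intro assms(9) semifield_isotopy_axioms.intro)
      (simp_all add: iso pm)
  then show ?thesis
    using quadratic_extension_isotope[OF plane] iso(1) by blast
qed

end
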